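(* Let $X$ and $Y$ be Stone spaces (zero-dimensional, compact Hausdorff). Let $T\colon C(X,\mathbb{S}^1)\to C(Y,\mathbb{S}^1)$ be a group isomorphism which is isometric with respect to the uniform metrics. Then there are a homeomorphism $\phi\colon Y\to X$ and a continuous function $p\colon Y\to\{\pm1\}$ such that $Tf(y)=f(\phi(y))^{p(y)}$ for all $f\in C(X,\mathbb{S}^1)$ and all $y\in Y$.
   Context: $\mathbb{S}^1=\{z\in\mathbb{C}:|z|=1\}$ is the circle group, and $C(X,\mathbb{S}^1)$ is the group (under pointwise multiplication) of continuous functions $X\to\mathbb{S}^1$, with the uniform metric $d_\infty(f,g)=\sup_{x\in X}|f(x)-g(x)|$. *)

theory Defs
  imports "HOL-Analysis.Analysis" "HOL-Algebra.Group"
begin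

definition zero_dimensional_space :: "'a topology \<Rightarrow> bool" where
  "zero_dimensional_space X \<longleftrightarrow>
     openin X = arbitrary union_of (\<lambda>U. openin X U \<and> closedin X U)"

definition Stone_space :: "'a topology \<Rightarrow> bool" where
  "Stone_space X \<longleftrightarrow> zero_dimensional_space X \<and> compact_space X \<and> Hausdorff_space X"

definition circle_metric :: "complex metric" where
  "circle_metric = submetric euclidean_metric (sphere 0 1)"

text \<open>The library's metric space \<open>cfunspace X m\<close> consists of the bounded continuous maps from
  \<open>X\<close> to \<open>m\<close>, made \<open>undefined\<close> outside \<open>topspace X\<close>, with the uniform metric (which is \<open>0\<close> if
  \<open>X\<close> is empty). Boundedness is automatic for the circle, see \<open>mspace_circle_functions\<close>.\<close>

definition circle_functions :: "'a topology \<Rightarrow> ('a \<Rightarrow> complex) metric" where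
  "circle_functions X = cfunspace X circle_metric"

definition circle_function_group :: "'a topology \<Rightarrow> ('a \<Rightarrow> complex) monoid" where
  "circle_function_group X =
     \<lparr>carrier = mspace (circle_functions X),
      mult = (\<lambda>f g. \<lambda>x\<in>topspace X. f x * g x),
      one = (\<lambda>x\<in>topspace X. 1)\<rparr>"

lemma mspace_circle_functions:
  "mspace (circle_functions X) =
     {f \<in> extensional (topspace X). continuous_map X (top_of_set (sphere 0 1)) f}"
proof -
  have top: "mtopology_of circle_metric = top_of_set (sphere 0 1)"
    by (simp add: circle_metric_def mtopology_of_submetric)
  have sub: "mspace circle_metric = sphere 0 1" and dst: "mdist circle_metric = dist"
    by (simp_all add: circle_metric_def)
  interpret M: Metric_space "sphere (0::complex) 1" dist
    by (metis Metric_space_mspace_mdist sub dst)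
  have "M.mbounded (f ` topspace X)" if "continuous_map X (top_of_set (sphere 0 1)) f" for f
  proof -
    have "f ` topspace X \<subseteq> sphere 0 1"
      using that continuous_map_image_subset_topspace by fastforce
    moreover have "dist 1 y \<le> 2" if "y \<in> sphere (0::complex) 1" for y
      using that norm_triangle_ineq4[of 1 y] by (simp add: dist_norm)
    ultimately show ?thesis
      unfolding M.mbounded_def M.mcball_def
      by (intro exI[of _ 1] exI[of _ 2]) auto
  qed
  then show ?thesis
    by (auto simp: circle_functions_def M.fspace_def sub dst top continuous_map_in_subtopology)
qed

lemma mdist_circle_functions:
  assumes "f \<in> mspace (circle_functions X)" "g \<in> mspace (circle_functions X)" "topspace X \<noteq> {}"
  shows "mdist (circle_functions X) f g = (SUP x\<in>topspace X. cmod (f x - g x))"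
proof -
  have sub: "mspace circle_metric = sphere 0 1" and dst: "mdist circle_metric = dist"
    by (simp_all add: circle_metric_def)
  interpret M: Metric_space "sphere (0::complex) 1" dist
    by (metis Metric_space_mspace_mdist sub dst)
  show ?thesis
    using assms
    by (simp add: circle_functions_def mdist_cfunspace_eq_mdist_funspace M.fdist_def M.fspace_def
        sub dst dist_norm image_subset_iff_funcset)
qed

lemma comm_group_circle_function_group: "comm_group (circle_function_group X)"
proof (rule comm_groupI)
  let ?G = "circle_function_group X"
  have carrier: "f \<in> carrier ?G \<longleftrightarrow>
      f \<in> extensional (topspace X) \<and> continuous_map X euclidean f \<and> (\<forall>x\<in>topspace X. cmod (f x) = 1)"
    for f
    by (auto simp: circle_function_group_def mspace_circle_functions
        continuous_map_in_subtopology image_subset_iff Pi_iff)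
  note [simp] = carrier
  have mult [simp]: "f \<otimes>\<^bsub>?G\<^esub> g = (\<lambda>x\<in>topspace X. f x * g x)" for f g
    by (simp add: circle_function_group_def)
  have one [simp]: "\<one>\<^bsub>?G\<^esub> = (\<lambda>x\<in>topspace X. 1)"
    by (simp add: circle_function_group_def)
  have restr: "continuous_map X euclidean (restrict f (topspace X)) \<longleftrightarrow> continuous_map X euclidean f"
    for f :: "'a \<Rightarrow> complex"
    by (metis continuous_map_eq restrict_apply')
  show "f \<otimes>\<^bsub>?G\<^esub> g \<in> carrier ?G" if "f \<in> carrier ?G" "g \<in> carrier ?G" for f g
  proof -
    have "continuous_map X euclidean (\<lambda>x. f x * g x)"
      using that by (simp add: continuous_map_atin tendsto_mult)
    with that show ?thesis
      by (simp add: norm_mult restr)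
  qed
  show "\<one>\<^bsub>?G\<^esub> \<in> carrier ?G"
    by (simp add: restr)
  show "f \<otimes>\<^bsub>?G\<^esub> g \<otimes>\<^bsub>?G\<^esub> h = f \<otimes>\<^bsub>?G\<^esub> (g \<otimes>\<^bsub>?G\<^esub> h)" for f g h
    by (auto simp: fun_eq_iff mult_ac)
  show "f \<otimes>\<^bsub>?G\<^esub> g = g \<otimes>\<^bsub>?G\<^esub> f" for f g
    by (auto simp: fun_eq_iff mult_ac)
  show "\<one>\<^bsub>?G\<^esub> \<otimes>\<^bsub>?G\<^esub> f = f" if "f \<in> carrier ?G" for f
    using that by (auto simp: fun_eq_iff extensional_def)
  show "\<exists>g\<in>carrier ?G. g \<otimes>\<^bsub>?G\<^esub> f = \<one>\<^bsub>?G\<^esub>" if "f \<in> carrier ?G" for f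
  proof (rule bexI[of _ "\<lambda>x\<in>topspace X. cnj (f x)"])
    have "cnj (f x) * f x = 1" if "x \<in> topspace X" for x
      using \<open>f \<in> carrier ?G\<close> that complex_norm_square[of "f x"] by (simp add: mult.commute)
    then show "(\<lambda>x\<in>topspace X. cnj (f x)) \<otimes>\<^bsub>?G\<^esub> f = \<one>\<^bsub>?G\<^esub>"
      by (auto simp: fun_eq_iff)
    have "continuous_map X euclidean (\<lambda>x. cnj (f x))"
      using that by (simp add: continuous_map_atin tendsto_cnj)
    with that show "(\<lambda>x\<in>topspace X. cnj (f x)) \<in> carrier ?G"
      by (simp add: restr)
  qed
qed

end

theory Submission
  imports Defs
begin

text \<open>For a unimodular function, being within distance \<open>sqrt 2\<close> of \<open>1\<close> means having nonnegative real
  part, so \<open>T\<close> preserves this property in both directions. It follows that \<open>T \<i>\<close> takes only the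
  values \<open>\<i>\<close> and \<open>-\<i>\<close>; this defines \<open>p\<close>, and after conjugating \<open>T\<close> where \<open>p = -1\<close> we may assume
  \<open>T \<i> = \<i>\<close>. Then \<open>T\<close> fixes all constants, and it maps the functions with values in \<open>{1, \<i>}\<close> to
  functions with values in \<open>{1, \<i>}\<close>. Such functions encode clopen sets, with disjointness expressed by the
  product having nonnegative real part, so \<open>T\<close> induces an isomorphism of Boolean algebras of clopen
  sets and, by compactness, a homeomorphism \<open>\<phi>\<close>. Multiplying by \<open>\<plusminus>\<i>\<close> on a clopen set \<open>U\<close> shows that
  \<open>T g = 1\<close> on the preimage of \<open>U\<close> under \<open>\<phi>\<close> whenever \<open>g = 1\<close> on \<open>U\<close> and \<open>Re g \<ge> 0\<close>.
  Approximation by functions that are constant near a point then gives \<open>T g = g \<circ> \<phi>\<close> for \<open>Re g \<ge> 0\<close>,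
  square roots give it for \<open>g\<close> avoiding \<open>-1\<close>, and a change of sign on a clopen set gives the general case.\<close>

section \<open>Unimodular complex numbers\<close>

lemma sum_squares_unit: "cmod z = 1 \<Longrightarrow> (Re z)\<^sup>2 + (Im z)\<^sup>2 = 1"
  by (metis cmod_power2 one_power2)

lemma dist_one_le_sqrt2_iff:
  assumes "cmod z = 1"
  shows "dist z 1 \<le> sqrt 2 \<longleftrightarrow> Re z \<ge> 0"
proof -
  have "(dist z 1)\<^sup>2 = 2 - 2 * Re z"
    using sum_squares_unit[OF assms]
    unfolding dist_norm cmod_power2 by (simp add: power2_eq_square algebra_simps)
  moreover have "dist z 1 \<le> sqrt 2 \<longleftrightarrow> (dist z 1)\<^sup>2 \<le> 2"
    by (metis abs_le_square_iff abs_of_nonneg real_sqrt_abs real_sqrt_le_iff zero_le_dist)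
  ultimately show ?thesis by simp
qed

lemma fourth_roots_of_unity:
  fixes z :: complex
  assumes "z * z * (z * z) = 1"
  shows "z = 1 \<or> z = -1 \<or> z = \<i> \<or> z = -\<i>"
proof -
  have "(z - 1) * (z + 1) * ((z - \<i>) * (z + \<i>)) = 0"
    using assms by (simp add: algebra_simps)
  then show ?thesis
    by (auto simp: eq_neg_iff_add_eq_0)
qed

lemma unit_eq_one:
  assumes "cmod z = 1" "Im z = 0" "Re z \<ge> 0"
  shows "z = 1"
  using assms sum_squares_unit[OF assms(1)] by (simp add: complex_eq_iff power2_eq_1_iff)

text \<open>For unit vectors the squared distance is 2 minus twice the inner product, so the bounds
  compare inner products; opposite \<open>w\<close> force equality of both coordinates.\<close>

lemma unit_eq_of_dist_le:
  assumes "cmod z = 1" "cmod c = 1"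
    and "\<And>w. w \<in> {1, -1, \<i>, -\<i>} \<Longrightarrow> dist z w \<le> dist c w"
  shows "z = c"
proof -
  have *: "(dist u w)\<^sup>2 = 2 - 2 * (Re u * Re w + Im u * Im w)" if "cmod u = 1" "cmod w = 1" for u w
    using that[THEN sum_squares_unit]
    unfolding dist_norm cmod_power2 by (simp add: power2_eq_square algebra_simps)
  have "Re c * Re w + Im c * Im w \<le> Re z * Re w + Im z * Im w" if "w \<in> {1, -1, \<i>, -\<i>}" for w
  proof -
    have "cmod w = 1" using that by auto
    moreover have "(dist z w)\<^sup>2 \<le> (dist c w)\<^sup>2"
      by (rule power_mono[OF assms(3)[OF that]]) simp
    ultimately show ?thesis
      using assms(1,2) by (simp add: *)
  qed
  from this[of 1] this[of "-1"] this[of \<i>] this[of "-\<i>"] show ?thesis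
    by (simp add: complex_eq_iff)
qed

section \<open>Clopen sets and circle-valued maps\<close>

abbreviation clopenin :: "'a topology \<Rightarrow> 'a set \<Rightarrow> bool" where
  "clopenin X U \<equiv> openin X U \<and> closedin X U"

lemma Stone_space_clopen_base:
  assumes "Stone_space X" "openin X W" "x \<in> W"
  shows "\<exists>U. clopenin X U \<and> x \<in> U \<and> U \<subseteq> W"
proof -
  have "(arbitrary union_of clopenin X) W"
    using assms(1,2) unfolding Stone_space_def zero_dimensional_space_def by metis
  then show ?thesis
    using assms(3) unfolding arbitrary_union_of_alt by blast
qed

text \<open>By compactness, finitely many clopen subsets of \<open>W\<close> cover \<open>C\<close>,
  and a finite union of clopen sets is clopen.\<close>

lemma Stone_space_clopen_between:
  assumes "Stone_space X" "closedin X C" "openin X W" "C \<subseteq> W"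
  obtains U where "clopenin X U" "C \<subseteq> U" "U \<subseteq> W"
proof -
  let ?\<U> = "{U. clopenin X U \<and> U \<subseteq> W}"
  have "compactin X C"
    using assms by (simp add: Stone_space_def closedin_compact_space)
  moreover have "C \<subseteq> \<Union>?\<U>"
    using Stone_space_clopen_base[OF assms(1,3)] assms(4) by blast
  moreover have "\<forall>U\<in>?\<U>. openin X U"
    by simp
  ultimately have "\<exists>\<F>. finite \<F> \<and> \<F> \<subseteq> ?\<U> \<and> C \<subseteq> \<Union>\<F>"
    unfolding compactin_def by (elim conjE allE[of _ ?\<U>] impE) (rule conjI)
  then obtain \<F> where \<F>: "finite \<F>" "\<F> \<subseteq> ?\<U>" "C \<subseteq> \<Union>\<F>"
    by (elim exE conjE)
  show thesis
  proof (rule that[of "\<Union>\<F>"])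
    show "clopenin X (\<Union>\<F>)"
      using \<F>(1,2) openin_Union[of \<F> X] closedin_Union[of \<F> X] by blast
    show "\<Union>\<F> \<subseteq> W"
      using \<F>(2) by blast
  qed (fact \<F>(3))
qed

text \<open>Values outside \<open>topspace X\<close> are left free, so that products and constants
  need no restriction.\<close>

definition circle_maps :: "'a topology \<Rightarrow> ('a \<Rightarrow> complex) set" where
  "circle_maps X = {f. continuous_map X (top_of_set (sphere 0 1)) f}"

lemma circle_maps_iff:
  "f \<in> circle_maps X \<longleftrightarrow> continuous_map X euclidean f \<and> (\<forall>x\<in>topspace X. cmod (f x) = 1)"
  by (auto simp: circle_maps_def continuous_map_in_subtopology image_subset_iff Pi_iff)

lemma circle_maps_norm: "f \<in> circle_maps X \<Longrightarrow> x \<in> topspace X \<Longrightarrow> cmod (f x) = 1"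
  by (simp add: circle_maps_iff)

lemma circle_maps_const: "cmod c = 1 \<Longrightarrow> (\<lambda>x. c) \<in> circle_maps X"
  by (simp add: circle_maps_iff)

lemma circle_maps_mult:
  "f \<in> circle_maps X \<Longrightarrow> g \<in> circle_maps X \<Longrightarrow> (\<lambda>x. f x * g x) \<in> circle_maps X"
  by (simp add: circle_maps_iff norm_mult continuous_map_atin tendsto_mult)

lemma circle_maps_cnj: "f \<in> circle_maps X \<Longrightarrow> (\<lambda>x. cnj (f x)) \<in> circle_maps X"
  by (simp add: circle_maps_iff continuous_map_atin tendsto_cnj)

lemma circle_maps_cong:
  "f \<in> circle_maps X \<Longrightarrow> (\<And>x. x \<in> topspace X \<Longrightarrow> f x = g x) \<Longrightarrow> g \<in> circle_maps X"
  unfolding circle_maps_iff by (metis continuous_map_eq)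

lemma continuous_map_clopen_cases:
  assumes "clopenin X A" "continuous_map X Z f" "continuous_map X Z g"
  shows "continuous_map X Z (\<lambda>x. if x \<in> A then f x else g x)"
proof -
  have "openin X {x \<in> topspace X. (if x \<in> A then f x else g x) \<in> W}" if "openin Z W" for W
  proof -
    have "{x \<in> topspace X. (if x \<in> A then f x else g x) \<in> W} =
        (A \<inter> {x \<in> topspace X. f x \<in> W}) \<union> ((topspace X - A) \<inter> {x \<in> topspace X. g x \<in> W})"
      by auto
    moreover have "openin X {x \<in> topspace X. f x \<in> W}" "openin X {x \<in> topspace X. g x \<in> W}"
      using assms that by (auto simp: openin_continuous_map_preimage)
    ultimately show ?thesis
      using assms by auto
  qed
  with assms show ?thesis
    by (auto simp: continuous_map)
qed

lemma circle_maps_cases: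
  "clopenin X A \<Longrightarrow> f \<in> circle_maps X \<Longrightarrow> g \<in> circle_maps X \<Longrightarrow>
    (\<lambda>x. if x \<in> A then f x else g x) \<in> circle_maps X"
  unfolding circle_maps_def by (simp add: continuous_map_clopen_cases)

text \<open>The complement of a fibre is the preimage of the finite, hence closed, set
  \<open>K - {c}\<close>.\<close>

lemma clopenin_fibre:
  assumes "continuous_map X euclidean f" "finite K" "f ` topspace X \<subseteq> K"
  shows "clopenin X {x \<in> topspace X. f x = (c :: complex)}"
proof -
  have *: "closedin X {x \<in> topspace X. f x \<in> L}" if "finite L" for L
    using assms(1) that by (intro closedin_continuous_map_preimage[of _ euclidean])
      (simp_all add: finite_imp_closed)
  have "{x \<in> topspace X. f x = c} = topspace X - {x \<in> topspace X. f x \<in> K - {c}}"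
    using assms(3) by auto
  with * [of "K - {c}"] * [of "{c}"] assms(2) show ?thesis
    by auto
qed

text \<open>An indicator whose two values have nonnegative real part; a product of two of them is
  \<open>-1\<close> exactly on the intersection.\<close>

definition clopen_char :: "'a set \<Rightarrow> 'a \<Rightarrow> complex" where
  "clopen_char U x = (if x \<in> U then \<i> else 1)"

lemma clopen_char_circle_maps: "clopenin X U \<Longrightarrow> clopen_char U \<in> circle_maps X"
  using circle_maps_cases[of X U "\<lambda>x. \<i>" "\<lambda>x. 1"]
  by (simp add: clopen_char_def[abs_def] circle_maps_const)

section \<open>Isometric isomorphisms\<close>

text \<open>Quantifying over all \<open>e\<close> replaces the uniform metric, with no case distinction for an empty space.\<close>

locale circle_isometry =
  fixes X :: "'a topology" and Y :: "'b topology" and S :: "('a \<Rightarrow> complex) \<Rightarrow> ('b \<Rightarrow> complex)"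
  assumes maps: "f \<in> circle_maps X \<Longrightarrow> S f \<in> circle_maps Y"
    and mult: "f \<in> circle_maps X \<Longrightarrow> g \<in> circle_maps X \<Longrightarrow> y \<in> topspace Y \<Longrightarrow>
      S (\<lambda>x. f x * g x) y = S f y * S g y"
    and isom: "f \<in> circle_maps X \<Longrightarrow> g \<in> circle_maps X \<Longrightarrow>
      (\<forall>y\<in>topspace Y. dist (S f y) (S g y) \<le> e) \<longleftrightarrow> (\<forall>x\<in>topspace X. dist (f x) (g x) \<le> e)"
    and surj: "h \<in> circle_maps Y \<Longrightarrow> \<exists>f\<in>circle_maps X. \<forall>y\<in>topspace Y. S f y = h y"
begin

lemma dist_le:
  assumes "f \<in> circle_maps X" "g \<in> circle_maps X" "\<And>x. x \<in> topspace X \<Longrightarrow> dist (f x) (g x) \<le> e"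
    and "y \<in> topspace Y"
  shows "dist (S f y) (S g y) \<le> e"
  using isom[OF assms(1,2), of e] assms(3,4) by blast

text \<open>Distance 0 on \<open>topspace X\<close> stays distance 0 under \<open>S\<close>.\<close>

lemma cong:
  assumes "f \<in> circle_maps X" "\<And>x. x \<in> topspace X \<Longrightarrow> f x = g x" "y \<in> topspace Y"
  shows "S f y = S g y"
proof -
  have "g \<in> circle_maps X"
    using assms(1,2) by (rule circle_maps_cong)
  then have "dist (S f y) (S g y) \<le> 0"
    using assms by (intro dist_le) auto
  then show ?thesis by simp
qed

lemma inj:
  assumes "f \<in> circle_maps X" "g \<in> circle_maps X" "\<And>y. y \<in> topspace Y \<Longrightarrow> S f y = S g y"
    and "x \<in> topspace X"
  shows "f x = g x"
proof -
  have "\<forall>y\<in>topspace Y. dist (S f y) (S g y) \<le> 0"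
    by (simp add: assms(3))
  then have "dist (f x) (g x) \<le> 0"
    using isom[OF assms(1,2), of 0] assms(4) by blast
  then show ?thesis by simp
qed

lemma norm_1: "f \<in> circle_maps X \<Longrightarrow> y \<in> topspace Y \<Longrightarrow> cmod (S f y) = 1"
  by (rule circle_maps_norm[OF maps])

lemma nonzero: "f \<in> circle_maps X \<Longrightarrow> y \<in> topspace Y \<Longrightarrow> S f y \<noteq> 0"
  using norm_1[of f y] by auto

lemma one: "y \<in> topspace Y \<Longrightarrow> S (\<lambda>x. 1) y = 1"
  using mult[of "\<lambda>x. 1" "\<lambda>x. 1" y] nonzero[of "\<lambda>x. 1" y] by (simp add: circle_maps_const)

lemma cnj: 
  assumes "f \<in> circle_maps X" "y \<in> topspace Y"
  shows "S (\<lambda>x. cnj (f x)) y = cnj (S f y)"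
proof -
  have "S f y * S (\<lambda>x. cnj (f x)) y = S (\<lambda>x. f x * cnj (f x)) y"
    using assms by (simp add: mult circle_maps_cnj)
  also have "\<dots> = S (\<lambda>x. 1) y"
    using assms by (intro cong circle_maps_mult circle_maps_cnj)
      (auto simp: circle_maps_norm complex_norm_square[symmetric])
  also have "\<dots> = S f y * cnj (S f y)"
    using assms by (simp add: one norm_1 complex_norm_square[symmetric])
  finally show ?thesis
    using nonzero[OF assms] by simp
qed

lemma Re_nonneg_iff:
  assumes "f \<in> circle_maps X"
  shows "(\<forall>y\<in>topspace Y. Re (S f y) \<ge> 0) \<longleftrightarrow> (\<forall>x\<in>topspace X. Re (f x) \<ge> 0)"
proof -
  have "(\<forall>y\<in>topspace Y. Re (S f y) \<ge> 0) \<longleftrightarrow> (\<forall>y\<in>topspace Y. dist (S f y) (S (\<lambda>x. 1) y) \<le> sqrt 2)"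
    using assms by (simp add: one dist_one_le_sqrt2_iff norm_1)
  also have "\<dots> \<longleftrightarrow> (\<forall>x\<in>topspace X. Re (f x) \<ge> 0)"
    using assms by (simp add: isom circle_maps_const dist_one_le_sqrt2_iff circle_maps_norm)
  finally show ?thesis .
qed

lemma Re_nonneg:
  "f \<in> circle_maps X \<Longrightarrow> (\<And>x. x \<in> topspace X \<Longrightarrow> Re (f x) \<ge> 0) \<Longrightarrow> y \<in> topspace Y \<Longrightarrow> Re (S f y) \<ge> 0"
  using Re_nonneg_iff[of f] by blast

lemma fourth_power:
  assumes "f \<in> circle_maps X" "y \<in> topspace Y"
    "\<And>x. x \<in> topspace X \<Longrightarrow> f x \<in> {1, -1, \<i>, -\<i>}"
  shows "S f y \<in> {1, -1, \<i>, -\<i>}"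
proof -
  have "S f y * S f y * (S f y * S f y) = S (\<lambda>x. (f x * f x) * (f x * f x)) y"
    using assms(1,2) by (simp add: mult circle_maps_mult)
  also have "\<dots> = S (\<lambda>x. 1) y"
    using assms by (intro cong) (auto intro!: circle_maps_mult dest!: assms(3))
  finally show ?thesis
    using fourth_roots_of_unity[of "S f y"] assms(2) by (simp add: one)
qed

text \<open>The only other possible value is \<open>1\<close>. If it were taken, it would be taken on a nonempty clopen set
  \<open>V\<close>; the preimage \<open>f\<close> of the function that is \<open>\<i>\<close> on \<open>V\<close> and \<open>1\<close> elsewhere would be such that \<open>f\<close>,
  \<open>\<i> f\<close> and \<open>\<i> / f\<close> all have nonnegative real part, which forces \<open>f = 1\<close>.\<close>

lemma const_ii:
  assumes "y \<in> topspace Y"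
  shows "S (\<lambda>x. \<i>) y \<in> {\<i>, -\<i>}"
proof (rule ccontr)
  assume neg: "S (\<lambda>x. \<i>) y \<notin> {\<i>, -\<i>}"
  have ci: "(\<lambda>x. \<i>) \<in> circle_maps X"
    by (simp add: circle_maps_const)
  have "Re (S (\<lambda>x. \<i>) y) \<ge> 0" if "y \<in> topspace Y" for y
    using that by (intro Re_nonneg ci) auto
  then have vals: "S (\<lambda>x. \<i>) y \<in> {1, \<i>, -\<i>}" if "y \<in> topspace Y" for y
    using fourth_power[OF ci that] that by force
  define V where "V = {y \<in> topspace Y. S (\<lambda>x. \<i>) y = 1}"
  have V: "clopenin Y V"
    unfolding V_def using maps[OF ci] vals
    by (intro clopenin_fibre[of _ _ "{1, \<i>, -\<i>}"]) (auto simp: circle_maps_iff)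
  obtain f where f: "f \<in> circle_maps X" "\<And>y. y \<in> topspace Y \<Longrightarrow> S f y = clopen_char V y"
    using surj[OF clopen_char_circle_maps[OF V]] by blast
  have "Re (f x) \<ge> 0 \<and> Re (\<i> * f x) \<ge> 0 \<and> Re (\<i> * cnj (f x)) \<ge> 0" if "x \<in> topspace X" for x
  proof -
    have "\<forall>y\<in>topspace Y. Re (S f y) \<ge> 0"
      by (simp add: f clopen_char_def)
    \<comment> \<open>\<open>S f\<close> is \<open>\<i>\<close> where
      \<open>S (\<lambda>x. \<i>)\<close> is \<open>1\<close>, and \<open>1\<close> where it is
      \<open>\<i>\<close> or \<open>-\<i>\<close>; the product, with \<open>S f\<close> conjugated
      or not, is purely imaginary.\<close>
    moreover have "\<forall>y\<in>topspace Y. Re (S (\<lambda>x. \<i> * f x) y) \<ge> 0"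
      using vals by (force simp: f ci mult clopen_char_def V_def)
    moreover have "\<forall>y\<in>topspace Y. Re (S (\<lambda>x. \<i> * cnj (f x)) y) \<ge> 0"
      using vals by (force simp: f ci mult circle_maps_cnj cnj clopen_char_def V_def)
    ultimately show ?thesis
      using that f(1) ci by (auto simp: Re_nonneg_iff circle_maps_mult circle_maps_cnj)
  qed
  \<comment> \<open>The last two conditions read \<open>Im (f x) \<le> 0\<close> and
    \<open>Im (f x) \<ge> 0\<close>.\<close>
  then have "f x = 1" if "x \<in> topspace X" for x
    using that circle_maps_norm[OF f(1) that] by (intro unit_eq_one) fastforce+
  then have "S f y = 1"
    using cong[of f "\<lambda>x. 1" y] assms f(1) one by simp
  moreover have "y \<in> V"
    using neg vals[OF assms] assms by (auto simp: V_def)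
  ultimately show False
    using f(2) assms by (simp add: clopen_char_def)
qed

text \<open>Conjugation is an isometric automorphism of the circle; switching it on along a clopen
  set keeps continuity.\<close>

lemma twist:
  assumes "clopenin Y P"
  shows "circle_isometry X Y (\<lambda>f y. if y \<in> P then S f y else cnj (S f y))"
proof
  let ?\<tau> = "\<lambda>g y. if y \<in> P then g y else cnj (g y)"
  have tw: "?\<tau> g \<in> circle_maps Y" if "g \<in> circle_maps Y" for g
    using that assms by (intro circle_maps_cases circle_maps_cnj)
  show "?\<tau> (S f) \<in> circle_maps Y" if "f \<in> circle_maps X" for f
    using that by (intro tw maps)
  show "?\<tau> (S (\<lambda>x. f x * g x)) y = ?\<tau> (S f) y * ?\<tau> (S g) y"
    if "f \<in> circle_maps X" "g \<in> circle_maps X" "y \<in> topspace Y" for f g y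
    using that by (simp add: mult)
  show "(\<forall>y\<in>topspace Y. dist (?\<tau> (S f) y) (?\<tau> (S g) y) \<le> e) \<longleftrightarrow> (\<forall>x\<in>topspace X. dist (f x) (g x) \<le> e)"
    if "f \<in> circle_maps X" "g \<in> circle_maps X" for f g e
  proof -
    have "dist (?\<tau> (S f) y) (?\<tau> (S g) y) = dist (S f y) (S g y)" for y
      by (simp add: dist_norm flip: complex_cnj_diff)
    then show ?thesis using isom[OF that] by simp
  qed
  show "\<exists>f\<in>circle_maps X. \<forall>y\<in>topspace Y. ?\<tau> (S f) y = g y" if "g \<in> circle_maps Y" for g
    \<comment> \<open>The twist is an involution, so a preimage of the twisted \<open>g\<close>
      under \<open>S\<close> works.\<close>
    using surj[OF tw[OF that]] by force
qed

end

section \<open>Normalized isometries and constants\<close>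

locale normalized_circle_isometry = circle_isometry +
  assumes ii: "y \<in> topspace Y \<Longrightarrow> S (\<lambda>x. \<i>) y = \<i>"
    and Stone_X: "Stone_space X" and Stone_Y: "Stone_space Y"
begin

text \<open>The fourth roots of unity are fixed, as \<open>-1\<close> is the square of
  \<open>\<i>\<close> and \<open>-\<i>\<close> its conjugate; distances to them determine a point of
  the circle.\<close>

lemma const:
  assumes "cmod c = 1" "y \<in> topspace Y"
  shows "S (\<lambda>x. c) y = c"
proof (rule unit_eq_of_dist_le)
  show "cmod (S (\<lambda>x. c) y) = 1"
    using assms by (intro norm_1 circle_maps_const)
  show "dist (S (\<lambda>x. c) y) w \<le> dist c w" if "w \<in> {1, -1, \<i>, -\<i>}" for w
  proof -
    have w: "cmod w = 1" using that by auto
    have "S (\<lambda>x. -1) y = -1"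
      using mult[of "\<lambda>x. \<i>" "\<lambda>x. \<i>" y] assms(2) by (simp add: ii circle_maps_const)
    moreover have "S (\<lambda>x. -\<i>) y = -\<i>"
      using cnj[of "\<lambda>x. \<i>" y] assms(2) by (simp add: ii circle_maps_const)
    ultimately have "S (\<lambda>x. w) y = w"
      using that ii one assms(2) by auto
    then show ?thesis
      using dist_le[of "\<lambda>x. c" "\<lambda>x. w" "dist c w" y] assms w by (simp add: circle_maps_const)
  qed
qed (use assms in auto)

text \<open>A rotated half-plane test: \<open>c = -\<i>\<close> tests the sign of the imaginary
  part.\<close>

lemma Re_nonneg_times_iff:
  assumes "f \<in> circle_maps X" "cmod c = 1"
  shows "(\<forall>y\<in>topspace Y. Re (S f y * c) \<ge> 0) \<longleftrightarrow> (\<forall>x\<in>topspace X. Re (f x * c) \<ge> 0)"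
proof -
  have "S (\<lambda>x. f x * c) y = S f y * c" if "y \<in> topspace Y" for y
    using mult[OF assms(1) circle_maps_const[OF assms(2)] that] const[OF assms(2) that] by simp
  then show ?thesis
    using Re_nonneg_iff[OF circle_maps_mult[OF assms(1) circle_maps_const[OF assms(2)]]] by simp
qed

section \<open>The clopen sets selected by a point of \<open>Y\<close>\<close>

lemma clopen_char_values:
  assumes "clopenin X U" "y \<in> topspace Y"
  shows "S (clopen_char U) y \<in> {1, \<i>}"
proof -
  note q = clopen_char_circle_maps[OF assms(1)]
  have "S (clopen_char U) y \<in> {1, -1, \<i>, -\<i>}"
    using assms(2) by (intro fourth_power q) (auto simp: clopen_char_def)
  moreover have "Re (S (clopen_char U) y) \<ge> 0"
    using assms(2) by (intro Re_nonneg q) (auto simp: clopen_char_def)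
  moreover have "\<forall>x\<in>topspace X. Re (clopen_char U x * (-\<i>)) \<ge> 0"
    by (auto simp: clopen_char_def)
  then have "Re (S (clopen_char U) y * (-\<i>)) \<ge> 0"
    using Re_nonneg_times_iff[OF q, of "-\<i>"] assms(2) by simp
  \<comment> \<open>Nonnegative real and imaginary parts leave only \<open>1\<close> and
    \<open>\<i>\<close> among the fourth roots.\<close>
  ultimately show ?thesis
    by auto
qed

text \<open>The ultrafilter of clopen neighbourhoods of the future image of
  \<open>y\<close>.\<close>

definition clopen_filter :: "'b \<Rightarrow> 'a set set" where
  "clopen_filter y = {U. clopenin X U \<and> S (clopen_char U) y = \<i>}"

lemma clopen_char_disjoint_Un:
  assumes "clopenin X U" "clopenin X V" "U \<inter> V = {}" "y \<in> topspace Y"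
  shows "S (clopen_char (U \<union> V)) y = S (clopen_char U) y * S (clopen_char V) y"
proof -
  have "S (clopen_char (U \<union> V)) y = S (\<lambda>x. clopen_char U x * clopen_char V x) y"
    using assms by (intro cong clopen_char_circle_maps) (auto simp: clopen_char_def)
  then show ?thesis
    using assms by (simp add: mult clopen_char_circle_maps)
qed

text \<open>Disjoint members would give their union the value \<open>\<i> * \<i> = -1\<close> at
  \<open>y\<close>, against \<open>clopen_char_values\<close>.\<close>

lemma clopen_filter_disjoint:
  assumes "U \<in> clopen_filter y" "V \<in> clopen_filter y" "y \<in> topspace Y"
  shows "U \<inter> V \<noteq> {}"
proof
  assume "U \<inter> V = {}"
  then have "S (clopen_char (U \<union> V)) y = -1" "clopenin X (U \<union> V)"
    using assms clopen_char_disjoint_Un[of U V y] by (auto simp: clopen_filter_def)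
  then show False
    using clopen_char_values[of "U \<union> V" y] assms(3) by (auto simp: complex_eq_iff)
qed

lemma clopen_filter_disjoint_Un:
  assumes "U \<union> V \<in> clopen_filter y" "clopenin X U" "clopenin X V" "U \<inter> V = {}" "y \<in> topspace Y"
  shows "U \<in> clopen_filter y \<or> V \<in> clopen_filter y"
  using clopen_char_disjoint_Un[OF assms(2-5)] clopen_char_values[of U y] clopen_char_values[of V y]
    assms by (auto simp: clopen_filter_def)

lemma topspace_clopen_filter: "y \<in> topspace Y \<Longrightarrow> topspace X \<in> clopen_filter y"
  using cong[of "\<lambda>x. \<i>" "clopen_char (topspace X)" y]
  by (simp add: clopen_filter_def clopen_char_def ii circle_maps_const)

text \<open>\<open>U\<close> splits into \<open>U \<inter> V\<close> and \<open>U - V\<close>; the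
  latter misses \<open>V\<close> and so cannot be a member.\<close>

lemma clopen_filter_Int:
  assumes "U \<in> clopen_filter y" "V \<in> clopen_filter y" "y \<in> topspace Y"
  shows "U \<inter> V \<in> clopen_filter y"
proof -
  have "(U \<inter> V) \<union> (U - V) = U" "(U \<inter> V) \<inter> (U - V) = {}" by auto
  moreover have "clopenin X (U \<inter> V)" "clopenin X (U - V)"
    using assms by (auto simp: clopen_filter_def openin_diff closedin_diff)
  moreover have "U - V \<notin> clopen_filter y"
    using clopen_filter_disjoint[of "U - V" y V] assms by auto
  ultimately show ?thesis
    using clopen_filter_disjoint_Un[of "U \<inter> V" "U - V" y] assms by metis
qed

lemma clopen_filter_Inter:
  assumes "finite \<F>" "\<F> \<subseteq> clopen_filter y" "y \<in> topspace Y"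
  shows "topspace X \<inter> \<Inter>\<F> \<in> clopen_filter y"
  using assms
proof (induction \<F>)
  case (insert U \<F>)
  then have "U \<inter> (topspace X \<inter> \<Inter>\<F>) \<in> clopen_filter y"
    using clopen_filter_Int[of U y "topspace X \<inter> \<Inter>\<F>"] by simp
  then show ?case
    by (simp add: Int_left_commute)
qed (simp add: topspace_clopen_filter)

section \<open>The point map as a homeomorphism\<close>

lemma ex_limit_point:
  assumes "y \<in> topspace Y"
  shows "\<exists>x\<in>topspace X. \<forall>U. clopenin X U \<longrightarrow> S (clopen_char U) y = clopen_char U x"
proof -
  \<comment> \<open>The finite intersection property; the members are closed, so compactness yields
    a common point.\<close>
  have "\<Inter>\<F> \<noteq> {}" if "finite \<F>" "\<F> \<subseteq> clopen_filter y" for \<F>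
    using clopen_filter_Inter[OF that assms] clopen_filter_disjoint[of _ y] assms by fast
  then have "\<Inter>(clopen_filter y) \<noteq> {}"
    using Stone_X unfolding Stone_space_def compact_space_fip
    by (auto simp: clopen_filter_def)
  then obtain x where x: "\<And>U. U \<in> clopen_filter y \<Longrightarrow> x \<in> U" by auto
  show ?thesis
  proof (intro bexI[of _ x] allI impI)
    show "x \<in> topspace X"
      using x topspace_clopen_filter assms by blast
    fix U assume U: "clopenin X U"
    then have co: "clopenin X (topspace X - U)" by auto
    have "U \<in> clopen_filter y \<or> topspace X - U \<in> clopen_filter y"
      using U co assms topspace_clopen_filter[of y] openin_subset[of X U]
      by (intro clopen_filter_disjoint_Un) (auto simp: Un_absorb1)
    then have "U \<in> clopen_filter y \<longleftrightarrow> x \<in> U"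
      using x by auto
    then show "S (clopen_char U) y = clopen_char U x"
      using U clopen_char_values[of U y] assms by (auto simp: clopen_filter_def clopen_char_def)
  qed
qed

text \<open>This becomes the homeomorphism \<phi>. Clopen sets separate the points of
  \<open>X\<close>, so for \<open>y\<close> in \<open>topspace Y\<close> the chosen point is
  unique.\<close>

definition point_map :: "'b \<Rightarrow> 'a" where
  "point_map y = (SOME x. x \<in> topspace X \<and> (\<forall>U. clopenin X U \<longrightarrow> S (clopen_char U) y = clopen_char U x))"

lemma
  assumes "y \<in> topspace Y"
  shows point_map_in: "point_map y \<in> topspace X"
    and point_map_char: "clopenin X U \<Longrightarrow> S (clopen_char U) y = clopen_char U (point_map y)"
  using someI_ex[OF ex_limit_point[OF assms, unfolded Bex_def]] by (auto simp: point_map_def)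

text \<open>The preimage of a clopen \<open>U\<close> is the fibre of
  \<open>S (clopen_char U)\<close> over \<open>\<i>\<close>, and clopen sets form a base.\<close>

lemma continuous_point_map: "continuous_map Y X point_map"
proof -
  have clopen: "openin Y {y \<in> topspace Y. point_map y \<in> U}" if "clopenin X U" for U
  proof -
    have "{y \<in> topspace Y. point_map y \<in> U} = {y \<in> topspace Y. S (clopen_char U) y = \<i>}"
      using that by (auto simp: point_map_char clopen_char_def split: if_splits)
    moreover have "clopenin Y \<dots>"
      using maps[OF clopen_char_circle_maps[OF that]] clopen_char_values[OF that]
      by (intro clopenin_fibre[of _ _ "{1, \<i>}"]) (auto simp: circle_maps_iff)
    ultimately show ?thesis by simp
  qed
  have "openin Y {y \<in> topspace Y. point_map y \<in> W}" if "openin X W" for W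
  proof (subst openin_subopen, intro ballI)
    fix y assume y: "y \<in> {y \<in> topspace Y. point_map y \<in> W}"
    then obtain U where "clopenin X U" "point_map y \<in> U" "U \<subseteq> W"
      using Stone_space_clopen_base[OF Stone_X \<open>openin X W\<close>, of "point_map y"] by auto
    with y show "\<exists>T. openin Y T \<and> y \<in> T \<and> T \<subseteq> {y \<in> topspace Y. point_map y \<in> W}"
      by (intro exI[of _ "{y \<in> topspace Y. point_map y \<in> U}"]) (use clopen in auto)
  qed
  then show ?thesis
    by (auto simp: continuous_map point_map_in)
qed

text \<open>Every clopen \<open>V\<close> in \<open>Y\<close> is the preimage of a clopen
  \<open>U\<close> in \<open>X\<close>, so it cannot separate points with the same image.\<close>

lemma inj_on_point_map: "inj_on point_map (topspace Y)"
proof (rule inj_onI, rule ccontr)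
  fix y z assume yz: "y \<in> topspace Y" "z \<in> topspace Y" "point_map y = point_map z" "y \<noteq> z"
  then obtain W where "openin Y W" "y \<in> W" "z \<notin> W"
    using Stone_Y unfolding Stone_space_def Hausdorff_space_def
    by (metis disjnt_iff)
  then obtain V where V: "clopenin Y V" "y \<in> V" "z \<notin> V"
    using Stone_space_clopen_base[OF Stone_Y, of W y] by blast
  obtain f where f: "f \<in> circle_maps X" "\<And>y. y \<in> topspace Y \<Longrightarrow> S f y = clopen_char V y"
    using surj[OF clopen_char_circle_maps[OF V(1)]] by blast
  \<comment> \<open>A converse of \<open>clopen_char_values\<close>: the fourth power is 1 by
    injectivity, and both half-plane tests pull back along \<open>S\<close>.\<close>
  have vals: "f x \<in> {1, \<i>}" if "x \<in> topspace X" for x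
  proof -
    have "(f x * f x) * (f x * f x) = 1"
    proof (rule inj[of "\<lambda>x. (f x * f x) * (f x * f x)" "\<lambda>x. 1"])
      show "S (\<lambda>x. (f x * f x) * (f x * f x)) y = S (\<lambda>x. 1) y" if "y \<in> topspace Y" for y
        using that f by (simp add: mult circle_maps_mult one clopen_char_def)
    qed (use f(1) that in \<open>auto intro!: circle_maps_mult circle_maps_const\<close>)
    then have "f x = 1 \<or> f x = -1 \<or> f x = \<i> \<or> f x = -\<i>"
      by (rule fourth_roots_of_unity)
    moreover have "\<forall>y\<in>topspace Y. Re (S f y) \<ge> 0"
      by (simp add: f clopen_char_def)
    then have "Re (f x) \<ge> 0"
      using that f(1) by (auto simp: Re_nonneg_iff)
    moreover have "\<forall>y\<in>topspace Y. Re (S f y * (-\<i>)) \<ge> 0"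
      by (simp add: f clopen_char_def)
    then have "Re (f x * (-\<i>)) \<ge> 0"
      using Re_nonneg_times_iff[OF f(1), of "-\<i>"] that by simp
    ultimately show ?thesis by auto
  qed
  define U where "U = {x \<in> topspace X. f x = \<i>}"
  have U: "clopenin X U"
    unfolding U_def using f(1) vals
    by (intro clopenin_fibre[of _ _ "{1, \<i>}"]) (auto simp: circle_maps_iff)
  have "S f y = clopen_char U (point_map y)" if "y \<in> topspace Y" for y
  proof -
    have "S f y = S (clopen_char U) y"
      using f(1) that vals by (intro cong) (auto simp: clopen_char_def U_def)
    then show ?thesis
      using that U by (simp add: point_map_char)
  qed
  then have "clopen_char V y = clopen_char V z"
    using f(2) yz by metis
  then show False
    using V by (simp add: clopen_char_def complex_eq_iff)
qed

text \<open>The image is compact, hence closed. If a nonempty clopen \<open>U\<close> missed it,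
  \<open>S\<close> would send the nontrivial \<open>clopen_char U\<close> to
  \<open>1\<close>.\<close>

lemma point_map_surj: "point_map ` topspace Y = topspace X"
proof (rule ccontr)
  assume "point_map ` topspace Y \<noteq> topspace X"
  then obtain x where x: "x \<in> topspace X - point_map ` topspace Y"
    using point_map_in by blast
  have "compactin X (point_map ` topspace Y)"
    using Stone_Y continuous_point_map
    by (intro image_compactin) (auto simp: Stone_space_def compact_space_def)
  then have "openin X (topspace X - point_map ` topspace Y)"
    using Stone_X by (simp add: Stone_space_def compactin_imp_closedin openin_diff)
  then obtain U where U: "clopenin X U" "x \<in> U" "U \<subseteq> topspace X - point_map ` topspace Y"
    using Stone_space_clopen_base[OF Stone_X] x by blast
  have "clopen_char U x = 1"
  proof (rule inj)
    show "S (clopen_char U) y = S (\<lambda>x. 1) y" if "y \<in> topspace Y" for y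
      using that U by (auto simp: point_map_char one clopen_char_def)
  qed (use x U in \<open>auto intro: clopen_char_circle_maps circle_maps_const\<close>)
  with U(2) show False
    by (simp add: clopen_char_def complex_eq_iff)
qed

lemma homeomorphic_point_map: "homeomorphic_map Y X point_map"
  using Stone_X Stone_Y
  by (intro continuous_imp_homeomorphic_map continuous_point_map point_map_surj inj_on_point_map)
    (auto simp: Stone_space_def)

section \<open>The isometry as composition with \<open>point_map\<close>\<close>

lemma local_one:
  assumes "clopenin X U" "g \<in> circle_maps X" "y \<in> topspace Y" "point_map y \<in> U"
    and one_on: "\<And>x. x \<in> U \<Longrightarrow> g x = 1" and Re: "\<And>x. x \<in> topspace X \<Longrightarrow> Re (g x) \<ge> 0"
  shows "S g y = 1"
proof (rule unit_eq_one)
  have q: "clopen_char U \<in> circle_maps X" "S (clopen_char U) y = \<i>"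
    using assms by (auto simp: clopen_char_circle_maps point_map_char clopen_char_def)
  have "Re (S (\<lambda>x. g x * clopen_char U x) y) \<ge> 0"
    using assms(2-3) by (intro Re_nonneg circle_maps_mult q(1)) (auto simp: clopen_char_def one_on Re)
  moreover have "Re (S (\<lambda>x. g x * cnj (clopen_char U x)) y) \<ge> 0"
    using assms(2-3) by (intro Re_nonneg circle_maps_mult circle_maps_cnj q(1)) (auto simp: clopen_char_def one_on Re)
  \<comment> \<open>The two real parts are \<open>- Im (S g y)\<close> and
    \<open>Im (S g y)\<close>.\<close>
  ultimately show "Im (S g y) = 0"
    using assms q by (simp add: mult cnj circle_maps_cnj)
qed (use assms in \<open>auto intro: norm_1 Re_nonneg\<close>)

lemma eq_if_Re_nonneg:
  assumes "g \<in> circle_maps X" "y \<in> topspace Y" and Re: "\<And>x. x \<in> topspace X \<Longrightarrow> Re (g x) \<ge> 0"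
  shows "S g y = g (point_map y)"
proof -
  define c where "c = g (point_map y)"
  have c: "cmod c = 1" "Re c \<ge> 0"
    using assms point_map_in[of y] by (auto simp: c_def circle_maps_norm)
  have "dist (S g y) c \<le> e" if "e > 0" for e
  proof -
    have "openin X {x \<in> topspace X. g x \<in> ball c e}"
      using assms(1) by (intro openin_continuous_map_preimage[of _ euclidean]) (auto simp: circle_maps_iff)
    moreover have "point_map y \<in> {x \<in> topspace X. g x \<in> ball c e}"
      using point_map_in assms(2) that by (simp add: c_def)
    ultimately obtain U where U: "clopenin X U" "point_map y \<in> U" "U \<subseteq> {x \<in> topspace X. g x \<in> ball c e}"
      using Stone_space_clopen_base[OF Stone_X, of "{x \<in> topspace X. g x \<in> ball c e}" "point_map y"] by blast
    \<comment> \<open>\<open>g'\<close> freezes \<open>g\<close> near the point, moving it by at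
      most \<open>e\<close>. Both \<open>a\<close> and \<open>b\<close> are \<open>1\<close> on
      \<open>U\<close> with nonnegative real part, and \<open>g' * b = a * c\<close> reduces
      \<open>g'\<close> to them.\<close>
    define g' where "g' = (\<lambda>x. if x \<in> U then c else g x)"
    define a where "a = (\<lambda>x. if x \<in> U then 1 else g x)"
    define b where "b = (\<lambda>x. if x \<in> U then 1 else c)"
    have circ: "g' \<in> circle_maps X" "a \<in> circle_maps X" "b \<in> circle_maps X"
      using U assms(1) c by (auto simp: g'_def a_def b_def intro!: circle_maps_cases circle_maps_const)
    have "S a y = 1"
      using U circ assms by (intro local_one[of U]) (auto simp: a_def)
    moreover have "S b y = 1"
      using U circ assms c by (intro local_one[of U]) (auto simp: b_def)
    moreover have "S g' y * S b y = S a y * c"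
    proof -
      have "S g' y * S b y = S (\<lambda>x. g' x * b x) y"
        using circ assms by (simp add: mult)
      also have "(\<lambda>x. g' x * b x) = (\<lambda>x. a x * c)"
        by (auto simp: g'_def a_def b_def)
      also have "S \<dots> y = S a y * c"
        using circ assms c by (simp add: mult const circle_maps_const)
      finally show ?thesis .
    qed
    ultimately have "S g' y = c" by simp
    moreover have "dist (S g y) (S g' y) \<le> e"
      using circ assms that U by (intro dist_le) (auto simp: g'_def dist_commute intro: less_imp_le)
    ultimately show ?thesis by simp
  qed
  then show ?thesis
    using field_le_epsilon[of "dist (S g y) c" 0] by (simp add: c_def)
qed

text \<open>\<open>csqrt\<close> is continuous off the nonpositive reals, which meet the circle only
  in \<open>-1\<close>, and its values have nonnegative real part.\<close>

lemma eq_if_neq_minus_one: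
  assumes g: "g \<in> circle_maps X" "y \<in> topspace Y" and neq: "\<And>x. x \<in> topspace X \<Longrightarrow> g x \<noteq> -1"
  shows "S g y = g (point_map y)"
proof -
  define r where "r = (\<lambda>x. csqrt (g x))"
  have np: "g x \<notin> \<real>\<^sub>\<le>\<^sub>0" if "x \<in> topspace X" for x
    using neq[OF that] circle_maps_norm[OF g(1) that]
    by (auto simp: complex_nonpos_Reals_iff complex_eq_iff cmod_def power2_eq_1_iff)
  have "continuous_map X (top_of_set (- \<real>\<^sub>\<le>\<^sub>0)) g"
    using g(1) np by (auto simp: continuous_map_in_subtopology circle_maps_iff)
  moreover have "continuous_map (top_of_set (- \<real>\<^sub>\<le>\<^sub>0)) euclidean csqrt"
    by (auto intro!: continuous_on_csqrt)
  ultimately have "continuous_map X euclidean r"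
    unfolding r_def using continuous_map_compose[of X "top_of_set (- \<real>\<^sub>\<le>\<^sub>0)" g euclidean csqrt]
    by (simp add: o_def)
  moreover have "cmod (r x) = 1" if "x \<in> topspace X" for x
    using circle_maps_norm[OF g(1) that] by (simp add: r_def norm_csqrt)
  ultimately have r: "r \<in> circle_maps X"
    by (simp add: circle_maps_iff)
  have sq: "g = (\<lambda>x. r x * r x)"
    by (simp add: r_def flip: power2_eq_square)
  have "S r y = r (point_map y)"
    using r g(2) by (intro eq_if_Re_nonneg) (auto simp: r_def Re_csqrt simp del: csqrt.sel)
  then show ?thesis
    using r g(2) by (simp add: sq mult)
qed

lemma eq_composition:
  assumes f: "f \<in> circle_maps X" "y \<in> topspace Y"
  shows "S f y = f (point_map y)"
proof -
  have cont: "continuous_map X euclidean (\<lambda>x. Re (f x))"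
    using f(1) by (simp add: circle_maps_iff continuous_map_atin tendsto_Re)
  have "closedin X {x \<in> topspace X. Re (f x) \<in> {..-1/2}}"
    by (rule closedin_continuous_map_preimage[OF cont]) auto
  moreover have "openin X {x \<in> topspace X. Re (f x) \<in> {..<1/2}}"
    by (rule openin_continuous_map_preimage[OF cont]) auto
  moreover have "{x \<in> topspace X. Re (f x) \<in> {..-1/2}} \<subseteq> {x \<in> topspace X. Re (f x) \<in> {..<1/2}}"
    by auto
  ultimately obtain U where U: "clopenin X U" "{x \<in> topspace X. Re (f x) \<in> {..-1/2}} \<subseteq> U"
      "U \<subseteq> {x \<in> topspace X. Re (f x) \<in> {..<1/2}}"
    by (rule Stone_space_clopen_between[OF Stone_X])
  define q where "q = clopen_char U"
  have q: "q \<in> circle_maps X" "S q y = q (point_map y)"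
    using U f(2) by (simp_all add: q_def clopen_char_circle_maps point_map_char)
  have "S (\<lambda>x. f x * (q x * q x)) y = f (point_map y) * (q (point_map y) * q (point_map y))"
  proof (rule eq_if_neq_minus_one)
    \<comment> \<open>The square of \<open>q\<close> is \<open>-1\<close> on \<open>U\<close>, where
      \<open>Re (f x) < 1/2\<close>, and \<open>1\<close> off \<open>U\<close>, where
      \<open>Re (f x) > -1/2\<close>; either way the product has real part above
      \<open>-1/2\<close>.\<close>
    show "f x * (q x * q x) \<noteq> -1" if "x \<in> topspace X" for x
      using U that by (auto simp: q_def clopen_char_def complex_eq_iff subset_iff)
  qed (use f q in \<open>auto intro!: circle_maps_mult\<close>)
  then have "S f y * (q (point_map y) * q (point_map y)) = f (point_map y) * (q (point_map y) * q (point_map y))"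
    using f q by (simp add: mult circle_maps_mult)
  then show ?thesis
    by (simp add: q_def clopen_char_def split: if_splits)
qed

end

section \<open>The group of circle-valued functions\<close>

lemma carrier_circle_function_group:
  "carrier (circle_function_group X) = circle_maps X \<inter> extensional (topspace X)"
  by (auto simp: circle_function_group_def mspace_circle_functions circle_maps_def)

lemma restrict_circle_maps:
  "f \<in> circle_maps X \<Longrightarrow> restrict f (topspace X) \<in> carrier (circle_function_group X)"
  using circle_maps_cong[of f X "restrict f (topspace X)"] by (simp add: carrier_circle_function_group)

lemma mdist_circle_functions_le_iff:
  assumes "f \<in> carrier (circle_function_group X)" "g \<in> carrier (circle_function_group X)"
    and "topspace X \<noteq> {}"
  shows "mdist (circle_functions X) f g \<le> e \<longleftrightarrow> (\<forall>x\<in>topspace X. dist (f x) (g x) \<le> e)"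
proof -
  \<comment> \<open>This bound makes the supremum a genuine least upper bound.\<close>
  have "cmod (f x - g x) \<le> 2" if "x \<in> topspace X" for x
    using norm_triangle_ineq4[of "f x" "g x"] that assms(1,2) circle_maps_norm[of f X x] circle_maps_norm[of g X x]
    by (simp add: carrier_circle_function_group)
  then have "bdd_above ((\<lambda>x. cmod (f x - g x)) ` topspace X)"
    by (rule bdd_aboveI2)
  then show ?thesis
    using assms by (simp add: mdist_circle_functions cSUP_le_iff circle_function_group_def dist_norm)
qed

text \<open>The constants \<open>1\<close> and \<open>-1\<close> differ as soon as there is a point,
  so the group detects emptiness.\<close>

lemma circle_function_group_trivial_iff:
  "(\<forall>f\<in>carrier (circle_function_group X). \<forall>g\<in>carrier (circle_function_group X). f = g) \<longleftrightarrow>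
    topspace X = {}"
proof
  assume triv: "\<forall>f\<in>carrier (circle_function_group X). \<forall>g\<in>carrier (circle_function_group X). f = g"
  have "restrict (\<lambda>x. 1) (topspace X) = restrict (\<lambda>x. -1 :: complex) (topspace X)"
    using triv by (simp add: restrict_circle_maps circle_maps_const)
  then show "topspace X = {}"
    by (metis all_not_in_conv one_neq_neg_one restrict_apply')
qed (auto simp: carrier_circle_function_group)

lemma circle_isometry_restrict:
  fixes X :: "'a topology" and Y :: "'b topology"
  assumes "T \<in> iso (circle_function_group X) (circle_function_group Y)"
    and T: "\<forall>f \<in> carrier (circle_function_group X). \<forall>g \<in> carrier (circle_function_group X).
           mdist (circle_functions Y) (T f) (T g) = mdist (circle_functions X) f g"
  shows "circle_isometry X Y (\<lambda>f. T (restrict f (topspace X)))"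
proof
  let ?G = "circle_function_group X" and ?H = "circle_function_group Y"
  let ?r = "\<lambda>f. restrict f (topspace X)"
  have hom: "T \<in> hom ?G ?H" and bij: "bij_betw T (carrier ?G) (carrier ?H)"
    using assms(1) by (auto simp: iso_def)
  have T_in: "T (?r f) \<in> carrier ?H" if "f \<in> circle_maps X" for f
    using hom restrict_circle_maps[OF that] by (auto simp: hom_def)
  show "T (?r f) \<in> circle_maps Y" if "f \<in> circle_maps X" for f
    using T_in[OF that] by (simp add: carrier_circle_function_group)
  show "T (?r (\<lambda>x. f x * g x)) y = T (?r f) y * T (?r g) y"
    if "f \<in> circle_maps X" "g \<in> circle_maps X" "y \<in> topspace Y" for f g y
  proof -
    have "?r (\<lambda>x. f x * g x) = ?r f \<otimes>\<^bsub>?G\<^esub> ?r g"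
      by (auto simp: circle_function_group_def)
    then have "T (?r (\<lambda>x. f x * g x)) = T (?r f) \<otimes>\<^bsub>?H\<^esub> T (?r g)"
      using hom that by (simp add: hom_mult restrict_circle_maps)
    then show ?thesis
      using that by (simp add: circle_function_group_def)
  qed
  \<comment> \<open>The supremum formula is available for nonempty spaces; the bijection
    \<open>T\<close> makes both spaces empty or neither.\<close>
  have empty_iff: "topspace X = {} \<longleftrightarrow> topspace Y = {}"
  proof -
    have "(\<forall>f\<in>carrier ?G. \<forall>g\<in>carrier ?G. f = g) \<longleftrightarrow> (\<forall>f\<in>carrier ?H. \<forall>g\<in>carrier ?H. f = g)"
      unfolding bij_betw_imp_surj_on[OF bij, symmetric]
      by (simp add: inj_on_eq_iff[OF bij_betw_imp_inj_on[OF bij]])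
    then show ?thesis
      by (simp only: circle_function_group_trivial_iff)
  qed
  show "(\<forall>y\<in>topspace Y. dist (T (?r f) y) (T (?r g) y) \<le> e) \<longleftrightarrow> (\<forall>x\<in>topspace X. dist (f x) (g x) \<le> e)"
    if "f \<in> circle_maps X" "g \<in> circle_maps X" for f g e
  proof (cases "topspace X = {}")
    case False
    then show ?thesis
      using mdist_circle_functions_le_iff[of "T (?r f)" Y "T (?r g)" e]
        mdist_circle_functions_le_iff[of "?r f" X "?r g" e] that T empty_iff
      by (simp add: T_in restrict_circle_maps)
  qed (use empty_iff in simp)
  show "\<exists>f\<in>circle_maps X. \<forall>y\<in>topspace Y. T (?r f) y = g y" if "g \<in> circle_maps Y" for g
  proof -
    obtain f where f: "f \<in> carrier ?G" "T f = restrict g (topspace Y)"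
      using restrict_circle_maps[OF \<open>g \<in> circle_maps Y\<close>] bij_betw_imp_surj_on[OF bij] by (metis imageE)
    then have "f \<in> circle_maps X" "?r f = f"
      by (auto simp: carrier_circle_function_group extensional_restrict)
    with f show ?thesis by (intro bexI[of _ f]) auto
  qed
qed

theorem theorem3p46:
  fixes X :: "'a topology" and Y :: "'b topology"
    and T :: "('a \<Rightarrow> complex) \<Rightarrow> ('b \<Rightarrow> complex)"
  assumes "Stone_space X" and "Stone_space Y"
    and "T \<in> iso (circle_function_group X) (circle_function_group Y)"
    and "\<forall>f \<in> carrier (circle_function_group X). \<forall>g \<in> carrier (circle_function_group X).
           mdist (circle_functions Y) (T f) (T g) = mdist (circle_functions X) f g"
  shows "\<exists>\<phi> p. homeomorphic_map Y X \<phi> \<and>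
           continuous_map Y (discrete_topology {-1, 1 :: int}) p \<and>
           (\<forall>f \<in> carrier (circle_function_group X). \<forall>y \<in> topspace Y.
              T f y = f (\<phi> y) powi p y)"
proof -
  define S where "S = (\<lambda>f. T (restrict f (topspace X)))"
  interpret S: circle_isometry X Y S
    unfolding S_def using assms(3,4) by (rule circle_isometry_restrict)
  \<comment> \<open>The set where \<open>p\<close> will be \<open>1\<close>; it is clopen as a fibre
    of a function with values in \<open>{\<i>, -\<i>}\<close>.\<close>
  define P where "P = {y \<in> topspace Y. S (\<lambda>x. \<i>) y = \<i>}"
  have P: "clopenin Y P"
    unfolding P_def using S.const_ii S.maps[of "\<lambda>x. \<i>"]
    by (intro clopenin_fibre[of _ _ "{\<i>, -\<i>}"]) (auto simp: circle_maps_iff)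
  define S' where "S' = (\<lambda>f y. if y \<in> P then S f y else cnj (S f y))"
  interpret S': circle_isometry X Y S'
    unfolding S'_def by (rule S.twist[OF P])
  interpret S': normalized_circle_isometry X Y S'
  proof
    show "S' (\<lambda>x. \<i>) y = \<i>" if "y \<in> topspace Y" for y
      using S.const_ii[OF that] that by (auto simp: S'_def P_def)
  qed (use assms in auto)
  define p :: "'b \<Rightarrow> int" where "p = (\<lambda>y. if y \<in> P then 1 else -1)"
  have "continuous_map Y (discrete_topology {-1, 1}) p"
    unfolding p_def by (rule continuous_map_clopen_cases[OF P]) auto
  moreover have "T f y = f (S'.point_map y) powi p y"
    if f: "f \<in> carrier (circle_function_group X)" and y: "y \<in> topspace Y" for f y
  proof -
    have fc: "f \<in> circle_maps X" "S f = T f"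
      using f by (auto simp: carrier_circle_function_group S_def extensional_restrict)
    have "cmod (f (S'.point_map y)) = 1"
      using fc(1) y by (simp add: circle_maps_norm S'.point_map_in)
    \<comment> \<open>The exponent \<open>-1\<close> means inversion, which on the circle is the
      conjugation that undoes the twist off \<open>P\<close>.\<close>
    then have inv: "inverse (f (S'.point_map y)) = cnj (f (S'.point_map y))"
      by (simp add: inverse_complex_def complex_eq_iff cmod_def)
    have S': "S' f y = f (S'.point_map y)"
      by (rule S'.eq_composition[OF fc(1) y])
    show ?thesis
    proof (cases "y \<in> P")
      case True
      then have "T f y = S' f y"
        using fc(2) by (simp add: S'_def)
      with True S' show ?thesis
        by (simp add: p_def)
    next
      case False
      then have "T f y = cnj (S' f y)"
        using fc(2) by (simp add: S'_def)
      with False S' inv show ?thesis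
        by (simp add: p_def power_int_minus)
    qed
  qed
  ultimately show ?thesis
    using S'.homeomorphic_point_map by blast
qed

end
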